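(* If $f:\mathbb{R}^2\to\mathbb{R}_{\mathcal{F}}$ is a $2\pi$-periodic continuous fuzzy valued function, i.e. $f\in C_{2\pi}^{(\mathcal{F})}(\mathbb{R}^2)$, then for all $\delta\in[0,\pi]$ $$\omega^{\mathcal{F}}\left(f\big|_{[0,2\pi]\times[0,2\pi]};\delta\right)\leq\omega^{\mathcal{F}}(f;\delta)\leq 3\,\omega^{\mathcal{F}}\left(f\big|_{[0,2\pi]\times[0,2\pi]};\delta\right).$$
   Context: A fuzzy number is a function $\mu:\mathbb{R}\to[0,1]$ that is normal ($\mu(t_0)=1$ for some $t_0$), fuzzy convex ($\mu(\lambda s+(1-\lambda)t)\ge\min\{\mu(s),\mu(t)\}$ for $\lambda\in[0,1]$), upper semicontinuous, and has compact support $\overline{\{t:\mu(t)>0\}}$. $\mathbb{R}_{\mathcal{F}}$ is the set of fuzzy numbers. The $\alpha$-level set is $[\mu]_\alpha=\{t:\mu(t)\ge\alpha\}$ for $0<\alpha\le1$ and $[\mu]_0=\overline{\{t:\mu(t)>0\}}$; it is a compact interval written $[\mu]_\alpha=[\mu_\alpha^-,\mu_\alpha^+]$. The metric on $\mathbb{R}_{\mathcal{F}}$ is $D(\mu,\eta)=\sup_{\alpha\in[0,1]}\max\{|\mu_\alpha^--\eta_\alpha^-|,|\mu_\alpha^+-\eta_\alpha^+|\}$. A function on $\mathbb{R}^2$ is $2\pi$-periodic if $f(u,v)=f(u+2n\pi,v)=f(u,v+2n\pi)$ for all $n\in\mathbb{Z}$ and all $(u,v)$. $C_{2\pi}^{(\mathcal{F})}(\mathbb{R}^2)$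 is the set of $2\pi$-periodic functions $f:\mathbb{R}^2\to\mathbb{R}_{\mathcal{F}}$ that are continuous with respect to $D$. For $K\subseteq\mathbb{R}^2$, $g:K\to\mathbb{R}_{\mathcal{F}}$ and $\delta\ge0$, the modulus of continuity is $\omega^{\mathcal{F}}(g;\delta)=\sup\{D(g(u,v),g(x,y)):(u,v),(x,y)\in K,\ \sqrt{(u-x)^2+(v-y)^2}\le\delta\}$; it is applied with $K=\mathbb{R}^2$ for $f$ and with $K=[0,2\pi]\times[0,2\pi]$ for the restriction of $f$. *)

theory Defs
  imports "HOL-Analysis.Analysis"
begin

definition upper_semicontinuous :: "('a::topological_space \<Rightarrow> real) \<Rightarrow> bool" where
  "upper_semicontinuous \<mu> \<longleftrightarrow> (\<forall>t c. \<mu> t < c \<longrightarrow> (\<forall>\<^sub>F s in nhds t. \<mu> s < c))"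

definition fuzzy_number :: "(real \<Rightarrow> real) \<Rightarrow> bool" where
  "fuzzy_number \<mu> \<longleftrightarrow>
     range \<mu> \<subseteq> {0..1} \<and>
     (\<exists>t. \<mu> t = 1) \<and>
     (\<forall>s t. \<forall>l\<in>{0..1}. \<mu> (l * s + (1 - l) * t) \<ge> min (\<mu> s) (\<mu> t)) \<and>
     upper_semicontinuous \<mu> \<and>
     compact (closure {t. \<mu> t > 0})"

lemma fuzzy_number_indicator_0: "fuzzy_number (indicator {0})"
proof -
  have "\<forall>\<^sub>F s in nhds t. indicator {0} s < c" if "indicator {0} t < c" for t c :: real
  proof (cases "t = 0")
    case True
    then have "indicator {0} s < c" for s :: real
      using that by (auto simp: indicator_def split: if_splits)
    then show ?thesis by simp
  next
    case False
    then have "\<forall>\<^sub>F s in nhds t. s \<in> - {0}"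
      by (intro eventually_nhds_in_open) auto
    then show ?thesis
      by eventually_elim (use that False in \<open>auto simp: indicator_def\<close>)
  qed
  moreover have "{t::real. indicator {0} t > (0::real)} = {0}"
    by (auto simp: indicator_def)
  ultimately show ?thesis
    unfolding fuzzy_number_def upper_semicontinuous_def
    by (auto simp: indicator_def)
qed

typedef fuzzy = "{\<mu>. fuzzy_number \<mu>}"
  morphisms membership Abs_fuzzy
  using fuzzy_number_indicator_0 by blast

definition level :: "fuzzy \<Rightarrow> real \<Rightarrow> real set" where
  "level \<mu> \<alpha> = (if \<alpha> = 0 then closure {t. membership \<mu> t > 0} else {t. membership \<mu> t \<ge> \<alpha>})"

text \<open>The end points of the interval \<^term>\<open>level \<mu> \<alpha>\<close>; see \<open>level_eq_interval\<close> below.\<close>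

definition level_lower :: "fuzzy \<Rightarrow> real \<Rightarrow> real" where
  "level_lower \<mu> \<alpha> = Inf (level \<mu> \<alpha>)"

definition level_upper :: "fuzzy \<Rightarrow> real \<Rightarrow> real" where
  "level_upper \<mu> \<alpha> = Sup (level \<mu> \<alpha>)"

lemma fuzzy_number_membership: "fuzzy_number (membership \<mu>)"
  using membership by auto

lemma level_antimono:
  assumes "0 \<le> \<alpha>" "\<alpha> \<le> \<beta>"
  shows "level \<mu> \<beta> \<subseteq> level \<mu> \<alpha>"
proof (cases "\<alpha> = 0")
  case True
  show ?thesis
  proof (cases "\<beta> = 0")
    case False
    then have "level \<mu> \<beta> \<subseteq> {t. membership \<mu> t > 0}"
      using assms by (auto simp: level_def)
    then show ?thesis
      using True closure_subset by (force simp: level_def)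
  qed (use True in auto)
qed (use assms in \<open>auto simp: level_def\<close>)

lemma level_nonempty:
  assumes "\<alpha> \<in> {0..1}"
  shows "level \<mu> \<alpha> \<noteq> {}"
proof -
  obtain t where "membership \<mu> t = 1"
    using fuzzy_number_membership[of \<mu>] unfolding fuzzy_number_def by auto
  then have "t \<in> level \<mu> 1" by (simp add: level_def)
  then show ?thesis using level_antimono[of \<alpha> 1 \<mu>] assms by auto
qed

lemma closed_level: "closed (level \<mu> \<alpha>)"
proof (cases "\<alpha> = 0")
  case False
  have usc: "upper_semicontinuous (membership \<mu>)"
    using fuzzy_number_membership[of \<mu>] unfolding fuzzy_number_def by auto
  have "open {t. membership \<mu> t < \<alpha>}"
  proof (subst open_subopen, intro ballI)
    fix t assume "t \<in> {t. membership \<mu> t < \<alpha>}"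
    then have "\<forall>\<^sub>F s in nhds t. membership \<mu> s < \<alpha>"
      using usc by (simp add: upper_semicontinuous_def)
    then show "\<exists>T. open T \<and> t \<in> T \<and> T \<subseteq> {t. membership \<mu> t < \<alpha>}"
      unfolding eventually_nhds by auto
  qed
  moreover have "- level \<mu> \<alpha> = {t. membership \<mu> t < \<alpha>}"
    using False by (auto simp: level_def)
  ultimately show ?thesis by (simp add: closed_def)
qed (simp add: level_def)

lemma compact_level:
  assumes "0 \<le> \<alpha>"
  shows "compact (level \<mu> \<alpha>)"
proof -
  have "compact (level \<mu> 0)"
    using fuzzy_number_membership[of \<mu>] unfolding fuzzy_number_def by (simp add: level_def)
  then have "compact (level \<mu> 0 \<inter> level \<mu> \<alpha>)"
    using closed_level by (rule compact_Int_closed)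
  then show ?thesis
    using level_antimono[of 0 \<alpha> \<mu>] assms by (simp add: Int_absorb1)
qed

lemma convex_level: "convex (level \<mu> \<alpha>)"
proof -
  have cvx: "membership \<mu> (u * s + v * t) \<ge> min (membership \<mu> s) (membership \<mu> t)"
    if "0 \<le> u" "0 \<le> v" "u + v = 1" for s t u v
  proof -
    have "v = 1 - u" "u \<in> {0..1}" using that by auto
    then show ?thesis
      using fuzzy_number_membership[of \<mu>] unfolding fuzzy_number_def by blast
  qed
  have "convex {t. membership \<mu> t > 0}" "convex {t. membership \<mu> t \<ge> \<alpha>}"
    unfolding convex_def by (auto intro: less_le_trans[OF _ cvx] order_trans[OF _ cvx])
  then show ?thesis by (auto simp: level_def intro: convex_closure)
qed

lemma level_eq_interval:
  assumes "\<alpha> \<in> {0..1}"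
  shows "level \<mu> \<alpha> = {level_lower \<mu> \<alpha>..level_upper \<mu> \<alpha>}"
proof -
  have "connected (level \<mu> \<alpha>)" "compact (level \<mu> \<alpha>)"
    using assms convex_connected[OF convex_level] compact_level by auto
  then obtain a b where ab: "level \<mu> \<alpha> = {a..b}"
    using connected_compact_interval_1 by (metis cbox_interval)
  then have "a \<le> b" using level_nonempty[OF assms, of \<mu>] by auto
  then show ?thesis using ab by (simp add: level_lower_def level_upper_def)
qed

lemma level_bounds:
  assumes "\<alpha> \<in> {0..1}"
  shows "level_lower \<mu> 0 \<le> level_lower \<mu> \<alpha>" "level_lower \<mu> \<alpha> \<le> level_upper \<mu> \<alpha>"
    "level_upper \<mu> \<alpha> \<le> level_upper \<mu> 0"
proof -
  have "level \<mu> \<alpha> \<subseteq> level \<mu> 0" using level_antimono[of 0 \<alpha> \<mu>] assms by auto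
  moreover have "level \<mu> \<alpha> \<noteq> {}" by (rule level_nonempty[OF assms])
  ultimately show "level_lower \<mu> 0 \<le> level_lower \<mu> \<alpha>"
    "level_lower \<mu> \<alpha> \<le> level_upper \<mu> \<alpha>" "level_upper \<mu> \<alpha> \<le> level_upper \<mu> 0"
    using level_eq_interval[of \<alpha> \<mu>] level_eq_interval[of 0 \<mu>] assms by auto
qed

lemma fuzzy_eqI:
  assumes "\<And>\<alpha>. \<alpha> \<in> {0..1} \<Longrightarrow> level \<mu> \<alpha> = level \<eta> \<alpha>"
  shows "\<mu> = \<eta>"
proof -
  have range: "membership \<nu> t \<in> {0..1}" for \<nu> t
    using fuzzy_number_membership[of \<nu>] unfolding fuzzy_number_def by blast
  have le: "membership \<mu> t \<le> membership \<eta> t"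
    if "\<And>\<alpha>. \<alpha> \<in> {0..1} \<Longrightarrow> level \<mu> \<alpha> = level \<eta> \<alpha>" for \<mu> \<eta> t
  proof (cases "membership \<mu> t = 0")
    case True
    then show ?thesis using range[of \<eta> t] by auto
  next
    case False
    then have "t \<in> level \<mu> (membership \<mu> t)" by (simp add: level_def)
    then have "t \<in> level \<eta> (membership \<mu> t)" using that range by auto
    then show ?thesis using False by (simp add: level_def)
  qed
  have "membership \<mu> = membership \<eta>"
    using le[of \<mu> \<eta>] le[of \<eta> \<mu>] assms by (intro ext antisym) auto
  then show ?thesis by (simp add: membership_inject)
qed

definition level_gap :: "fuzzy \<Rightarrow> fuzzy \<Rightarrow> real \<Rightarrow> real" where
  "level_gap \<mu> \<eta> \<alpha> =
     max \<bar>level_lower \<mu> \<alpha> - level_lower \<eta> \<alpha>\<bar> \<bar>level_upper \<mu> \<alpha> - level_upper \<eta> \<alpha>\<bar>"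

lemma bdd_above_level_gap: "bdd_above (level_gap \<mu> \<eta> ` {0..1})"
proof (rule bdd_aboveI2)
  fix \<alpha> :: real assume "\<alpha> \<in> {0..1}"
  then show "level_gap \<mu> \<eta> \<alpha> \<le> \<bar>level_lower \<mu> 0\<bar> + \<bar>level_upper \<mu> 0\<bar> + \<bar>level_lower \<eta> 0\<bar> + \<bar>level_upper \<eta> 0\<bar>"
    using level_bounds[of \<alpha> \<mu>] level_bounds[of \<alpha> \<eta>] unfolding level_gap_def by linarith
qed

instantiation fuzzy :: metric_space
begin

definition dist_fuzzy :: "fuzzy \<Rightarrow> fuzzy \<Rightarrow> real" where
  "dist_fuzzy \<mu> \<eta> = (SUP \<alpha>\<in>{0..1}. level_gap \<mu> \<eta> \<alpha>)"

definition uniformity_fuzzy :: "(fuzzy \<times> fuzzy) filter" where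
  "uniformity_fuzzy = (INF e\<in>{0<..}. principal {(x, y). dist x y < e})"

definition open_fuzzy :: "fuzzy set \<Rightarrow> bool" where
  "open_fuzzy U \<longleftrightarrow> (\<forall>x\<in>U. \<forall>\<^sub>F (x', y) in uniformity. x' = x \<longrightarrow> y \<in> U)"

instance
proof
  fix \<mu> \<eta> \<nu> :: fuzzy
  have gap_le: "level_gap \<mu> \<eta> \<alpha> \<le> dist \<mu> \<eta>" if "\<alpha> \<in> {0..1}" for \<mu> \<eta> \<alpha>
    unfolding dist_fuzzy_def using that bdd_above_level_gap by (rule cSUP_upper)
  show "dist \<mu> \<eta> = 0 \<longleftrightarrow> \<mu> = \<eta>"
  proof
    assume 0: "dist \<mu> \<eta> = 0"
    show "\<mu> = \<eta>"
    proof (rule fuzzy_eqI)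
      fix \<alpha> :: real assume \<alpha>: "\<alpha> \<in> {0..1}"
      then have "level_lower \<mu> \<alpha> = level_lower \<eta> \<alpha>" "level_upper \<mu> \<alpha> = level_upper \<eta> \<alpha>"
        using gap_le[of \<alpha> \<mu> \<eta>] 0 unfolding level_gap_def by auto
      then show "level \<mu> \<alpha> = level \<eta> \<alpha>" using \<alpha> by (simp add: level_eq_interval)
    qed
  qed (simp add: dist_fuzzy_def level_gap_def)
  show "dist \<mu> \<eta> \<le> dist \<mu> \<nu> + dist \<eta> \<nu>"
    unfolding dist_fuzzy_def[of \<mu> \<eta>]
  proof (rule cSUP_least)
    fix \<alpha> :: real assume "\<alpha> \<in> {0..1}"
    then show "level_gap \<mu> \<eta> \<alpha> \<le> dist \<mu> \<nu> + dist \<eta> \<nu>"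
      using gap_le[of \<alpha> \<mu> \<nu>] gap_le[of \<alpha> \<eta> \<nu>] unfolding level_gap_def by linarith
  qed simp
qed (simp_all add: uniformity_fuzzy_def open_fuzzy_def)

end

definition periodic_2pi :: "(real \<times> real \<Rightarrow> 'a) \<Rightarrow> bool" where
  "periodic_2pi f \<longleftrightarrow>
     (\<forall>n::int. \<forall>u v. f (u, v) = f (u + 2 * of_int n * pi, v) \<and> f (u, v) = f (u, v + 2 * of_int n * pi))"

definition C_2pi_fuzzy :: "(real \<times> real \<Rightarrow> fuzzy) set" where
  "C_2pi_fuzzy = {f. periodic_2pi f \<and> continuous_on UNIV f}"

text \<open>The modulus of a function on \<open>K\<close>, depending only on the values of \<open>g\<close> on \<open>K\<close>; so
  \<open>modulus K f\<close> is the modulus of the restriction of \<open>f\<close> to \<open>K\<close>. The supremum is taken in the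
  reals; for a continuous periodic function it is over a nonempty bounded set when \<open>\<delta> \<ge> 0\<close> and
  \<open>K\<close> is nonempty, see \<open>bdd_above_modulus_set\<close>.\<close>

definition modulus_set :: "(real \<times> real) set \<Rightarrow> (real \<times> real \<Rightarrow> fuzzy) \<Rightarrow> real \<Rightarrow> real set" where
  "modulus_set K g \<delta> =
     {dist (g (u, v)) (g (x, y)) | u v x y.
        (u, v) \<in> K \<and> (x, y) \<in> K \<and> sqrt ((u - x)\<^sup>2 + (v - y)\<^sup>2) \<le> \<delta>}"

definition modulus :: "(real \<times> real) set \<Rightarrow> (real \<times> real \<Rightarrow> fuzzy) \<Rightarrow> real \<Rightarrow> real" where
  "modulus K g \<delta> = Sup (modulus_set K g \<delta>)"

lemma bounded_range_C_2pi_fuzzy: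
  assumes "f \<in> C_2pi_fuzzy"
  shows "bounded (range f)"
proof -
  have per: "periodic_2pi f" and cont: "continuous_on UNIV f"
    using assms by (auto simp: C_2pi_fuzzy_def)
  let ?S = "{0..2 * pi} \<times> {0..2 * pi}"
  have red: "\<exists>n::int. x + 2 * of_int n * pi \<in> {0..2 * pi}" for x :: real
  proof
    have "x = (x / (2 * pi)) * (2 * pi)" by simp
    moreover have "of_int \<lfloor>x / (2 * pi)\<rfloor> * (2 * pi) \<le> (x / (2 * pi)) * (2 * pi)"
      by (intro mult_right_mono) auto
    moreover have "(x / (2 * pi)) * (2 * pi) \<le> (of_int \<lfloor>x / (2 * pi)\<rfloor> + 1) * (2 * pi)"
      by (intro mult_right_mono) (linarith, simp)
    ultimately show "x + 2 * of_int (- \<lfloor>x / (2 * pi)\<rfloor>) * pi \<in> {0..2 * pi}"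
      by (simp add: algebra_simps)
  qed
  have "f (u, v) \<in> f ` ?S" for u v
  proof -
    obtain m n :: int where
      "u + 2 * of_int m * pi \<in> {0..2 * pi}" "v + 2 * of_int n * pi \<in> {0..2 * pi}"
      using red by meson
    moreover have "f (u, v) = f (u + 2 * of_int m * pi, v + 2 * of_int n * pi)"
      using per unfolding periodic_2pi_def by metis
    ultimately show ?thesis by blast
  qed
  then have "range f \<subseteq> f ` ?S" by auto
  moreover have "compact (f ` ?S)"
    by (intro compact_continuous_image compact_Times continuous_on_subset[OF cont]) auto
  ultimately show ?thesis using compact_imp_bounded bounded_subset by blast
qed

lemma bdd_above_modulus_set:
  assumes "f \<in> C_2pi_fuzzy"
  shows "bdd_above (modulus_set K f \<delta>)"
proof -
  obtain e where "\<And>p q. dist (f p) (f q) \<le> e"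
    using bounded_range_C_2pi_fuzzy[OF assms] unfolding bounded_two_points by auto
  then show ?thesis by (intro bdd_aboveI[of _ e]) (auto simp: modulus_set_def)
qed

end

theory Submission
  imports Defs
begin

text \<open>A segment of length at most \<open>\<pi>\<close> meets at most one vertical and at most one horizontal line
  of the grid \<open>2\<pi>\<int>\<close> transversally. Cutting it at these crossings leaves at most three pieces, each
  inside a single cell of the grid; by periodicity a piece can be moved into \<open>[0,2\<pi>]\<^sup>2\<close>, and
  the triangle inequality gives the factor 3.\<close>

lemma exists_int_shift:
  fixes x :: real
  obtains n :: int where "x + 2 * of_int n * pi \<in> {0..2 * pi}"
proof
  have "of_int \<lfloor>x / (2 * pi)\<rfloor> * (2 * pi) \<le> (x / (2 * pi)) * (2 * pi)"
    by (intro mult_right_mono) auto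
  moreover have "(x / (2 * pi)) * (2 * pi) \<le> (of_int \<lfloor>x / (2 * pi)\<rfloor> + 1) * (2 * pi)"
    by (intro mult_right_mono) (linarith, simp)
  ultimately show "x + 2 * of_int (- \<lfloor>x / (2 * pi)\<rfloor>) * pi \<in> {0..2 * pi}"
    by (simp add: algebra_simps)
qed

text \<open>An affine function of \<open>t\<close> is monotone, rising or falling with the sign of
  \<open>d\<close>, so staying in an interval on all of \<open>{r..s}\<close> only has to be checked
  at \<open>r\<close> and \<open>s\<close>.\<close>

lemma affine_between:
  fixes a d k l h r s t :: real
  assumes "a + r * d + k \<in> {l..h}" "a + s * d + k \<in> {l..h}" "t \<in> {r..s}"
  shows "a + t * d + k \<in> {l..h}"
proof (cases "d \<ge> 0")
  case True
  then have "r * d \<le> t * d" "t * d \<le> s * d"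
    using assms(3) by (auto intro: mult_right_mono)
  then show ?thesis using assms(1,2) by auto
next
  case False
  then have "s * d \<le> t * d" "t * d \<le> r * d"
    using assms(3) by (auto intro: mult_right_mono_neg)
  then show ?thesis using assms(1,2) by auto
qed

text \<open>This treats one coordinate of the segment. A displacement of at most one period leaves
  the starting cell at most once, at parameter \<open>s\<close>; \<open>m\<close> and
  \<open>n\<close> are the shifts that bring the parts before and after the crossing into the base
  period.\<close>

lemma segment_crossing:
  fixes a d :: real
  assumes "\<bar>d\<bar> \<le> 2 * pi"
  obtains s :: real and m n :: int where "s \<in> {0..1}"
    "\<And>t. t \<in> {0..s} \<Longrightarrow> a + t * d + 2 * of_int m * pi \<in> {0..2 * pi}"
    "\<And>t. t \<in> {s..1} \<Longrightarrow> a + t * d + 2 * of_int n * pi \<in> {0..2 * pi}"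
proof -
  obtain m :: int where m: "a + 2 * of_int m * pi \<in> {0..2 * pi}"
    by (rule exists_int_shift)
  define a' where "a' = a + 2 * of_int m * pi"
  have a': "0 \<le> a'" "a' \<le> 2 * pi" using m by (auto simp: a'_def)
  \<comment> \<open>At the crossing both shifts must land in the closed interval, one at each end of
    it. The form \<open>1 * d\<close> fits \<open>affine_between\<close> at parameter 1.\<close>
  have "\<exists>s n::int. s \<in> {0..1} \<and> a + s * d + 2 * of_int m * pi \<in> {0..2 * pi} \<and>
      a + s * d + 2 * of_int n * pi \<in> {0..2 * pi} \<and> a + 1 * d + 2 * of_int n * pi \<in> {0..2 * pi}"
  proof -
    consider "a' + d \<in> {0..2 * pi}" | "a' + d > 2 * pi" | "a' + d < 0" by fastforce
    then show ?thesis
    proof cases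
      case 1
      \<comment> \<open>No crossing: with \<open>s = 1\<close> and \<open>n = m\<close> the second
        part is a single point.\<close>
      then show ?thesis
        by (intro exI[of _ 1] exI[of _ m]) (auto simp: a'_def algebra_simps)
    next
      case 2
      \<comment> \<open>Exit through \<open>2 * pi\<close>: \<open>s\<close> solves
        \<open>a' + s * d = 2 * pi\<close>. One period less moves the crossing to 0, and
        \<open>d \<le> 2 * pi\<close> keeps the end point in the cell.\<close>
      then have "d > 0" using a' by linarith
      then have "(2 * pi - a') / d \<in> {0..1}" "(2 * pi - a') / d * d = 2 * pi - a'"
        using 2 a' by (auto simp: field_simps)
      then show ?thesis
        using 2 a' assms
        by (intro exI[of _ "(2 * pi - a') / d"] exI[of _ "m - 1"]) (auto simp: a'_def algebra_simps)
    next
      case 3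
      \<comment> \<open>Mirror image: exit through 0, which one period more moves to
        \<open>2 * pi\<close>.\<close>
      then have "d < 0" using a' by linarith
      then have "- a' / d \<in> {0..1}" "- a' / d * d = - a'"
        using 3 a' by (auto simp: field_simps)
      then show ?thesis
        using 3 a' assms
        by (intro exI[of _ "- a' / d"] exI[of _ "m + 1"]) (auto simp: a'_def algebra_simps)
    qed
  qed
  then obtain s and n :: int where sn: "s \<in> {0..1}" "a + s * d + 2 * of_int m * pi \<in> {0..2 * pi}"
      "a + s * d + 2 * of_int n * pi \<in> {0..2 * pi}" "a + 1 * d + 2 * of_int n * pi \<in> {0..2 * pi}"
    by blast
  have m0: "a + 0 * d + 2 * of_int m * pi \<in> {0..2 * pi}" using m by simp
  show ?thesis
    using that[OF sn(1) affine_between[OF m0 sn(2)] affine_between[OF sn(3,4)]] by blast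
qed

lemma dist_le_modulus:
  assumes "f \<in> C_2pi_fuzzy" "(u, v) \<in> K" "(x, y) \<in> K" "sqrt ((u - x)\<^sup>2 + (v - y)\<^sup>2) \<le> \<delta>"
  shows "dist (f (u, v)) (f (x, y)) \<le> modulus K f \<delta>"
  unfolding modulus_def
  by (rule cSup_upper[OF _ bdd_above_modulus_set[OF assms(1)]])
    (use assms in \<open>unfold modulus_set_def, blast\<close>)

lemma periodic_2pi_shift:
  assumes "periodic_2pi f"
  shows "f (u + 2 * of_int m * pi, v + 2 * of_int n * pi) = f (u, v)"
  using assms unfolding periodic_2pi_def by metis

theorem lemma1p1:
  fixes f :: "real \<times> real \<Rightarrow> fuzzy" and \<delta> :: real
  assumes "f \<in> C_2pi_fuzzy" and "\<delta> \<in> {0..pi}"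
  shows "modulus ({0..2 * pi} \<times> {0..2 * pi}) f \<delta> \<le> modulus UNIV f \<delta> \<and>
         modulus UNIV f \<delta> \<le> 3 * modulus ({0..2 * pi} \<times> {0..2 * pi}) f \<delta>"
proof
  let ?I = "{0..2 * pi}"
  let ?M = "modulus (?I \<times> ?I) f \<delta>"
  \<comment> \<open>Comparing real suprema requires nonempty sets; the origin paired with itself has
    distance 0 \<le> \<delta>.\<close>
  have nonempty: "modulus_set K f \<delta> \<noteq> {}" if "(0, 0) \<in> K" for K
    using that assms(2) unfolding modulus_set_def by force
  have "modulus_set (?I \<times> ?I) f \<delta> \<subseteq> modulus_set UNIV f \<delta>"
    unfolding modulus_set_def by blast
  then show "?M \<le> modulus UNIV f \<delta>"
    unfolding modulus_def
    by (intro cSup_subset_mono nonempty bdd_above_modulus_set[OF assms(1)]) auto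
  have per: "periodic_2pi f" using assms(1) by (simp add: C_2pi_fuzzy_def)
  have main: "dist (f (u, v)) (f (x, y)) \<le> 3 * ?M"
    if le: "sqrt ((u - x)\<^sup>2 + (v - y)\<^sup>2) \<le> \<delta>" for u v x y
  proof -
    define P where "P t = (u + t * (x - u), v + t * (y - v))" for t
    have "\<bar>x - u\<bar> \<le> sqrt ((u - x)\<^sup>2 + (v - y)\<^sup>2)" "\<bar>y - v\<bar> \<le> sqrt ((u - x)\<^sup>2 + (v - y)\<^sup>2)"
      by (auto intro!: real_le_rsqrt simp: power2_commute)
    then have "\<bar>x - u\<bar> \<le> 2 * pi" "\<bar>y - v\<bar> \<le> 2 * pi"
      using le assms(2) pi_gt_zero by auto
    obtain s and m m' :: int where s: "s \<in> {0..1}"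
        "\<And>t. t \<in> {0..s} \<Longrightarrow> u + t * (x - u) + 2 * of_int m * pi \<in> ?I"
        "\<And>t. t \<in> {s..1} \<Longrightarrow> u + t * (x - u) + 2 * of_int m' * pi \<in> ?I"
      using segment_crossing[OF \<open>\<bar>x - u\<bar> \<le> 2 * pi\<close>] by blast
    obtain r and n n' :: int where r: "r \<in> {0..1}"
        "\<And>t. t \<in> {0..r} \<Longrightarrow> v + t * (y - v) + 2 * of_int n * pi \<in> ?I"
        "\<And>t. t \<in> {r..1} \<Longrightarrow> v + t * (y - v) + 2 * of_int n' * pi \<in> ?I"
      using segment_crossing[OF \<open>\<bar>y - v\<bar> \<le> 2 * pi\<close>] by blast
    \<comment> \<open>If neither crossing parameter lies strictly between \<open>t\<close> and
      \<open>t'\<close>, each coordinate has one shift that serves both end points.\<close>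
    have piece: "dist (f (P t)) (f (P t')) \<le> ?M"
      if t: "0 \<le> t" "t \<le> t'" "t' \<le> 1" "t' \<le> s \<or> s \<le> t" "t' \<le> r \<or> r \<le> t" for t t'
    proof -
      have "\<exists>k::int. u + t * (x - u) + 2 * of_int k * pi \<in> ?I \<and>
          u + t' * (x - u) + 2 * of_int k * pi \<in> ?I"
        using t(4)
      proof
        assume "t' \<le> s" then show ?thesis using s(2)[of t] s(2)[of t'] t by auto
      next
        assume "s \<le> t" then show ?thesis using s(3)[of t] s(3)[of t'] t by auto
      qed
      then obtain k :: int where k: "u + t * (x - u) + 2 * of_int k * pi \<in> ?I"
          "u + t' * (x - u) + 2 * of_int k * pi \<in> ?I" by blast
      have "\<exists>l::int. v + t * (y - v) + 2 * of_int l * pi \<in> ?I \<and>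
          v + t' * (y - v) + 2 * of_int l * pi \<in> ?I"
        using t(5)
      proof
        assume "t' \<le> r" then show ?thesis using r(2)[of t] r(2)[of t'] t by auto
      next
        assume "r \<le> t" then show ?thesis using r(3)[of t] r(3)[of t'] t by auto
      qed
      then obtain l :: int where l: "v + t * (y - v) + 2 * of_int l * pi \<in> ?I"
          "v + t' * (y - v) + 2 * of_int l * pi \<in> ?I" by blast
      \<comment> \<open>The common shifts cancel in \<open>?D\<close>, leaving the squared length of
        the segment scaled by \<open>(t' - t)\<^sup>2 \<le> 1\<close>.\<close>
      let ?D = "((u + t * (x - u) + 2 * of_int k * pi) - (u + t' * (x - u) + 2 * of_int k * pi))\<^sup>2 +
        ((v + t * (y - v) + 2 * of_int l * pi) - (v + t' * (y - v) + 2 * of_int l * pi))\<^sup>2"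
      have "?D = (t' - t)\<^sup>2 * ((u - x)\<^sup>2 + (v - y)\<^sup>2)"
        by (simp add: power2_eq_square algebra_simps)
      also have "\<dots> \<le> 1 * ((u - x)\<^sup>2 + (v - y)\<^sup>2)"
        using t by (intro mult_right_mono) (auto simp: power_le_one)
      finally have "sqrt ?D \<le> \<delta>" using le by (auto intro: order_trans[OF real_sqrt_le_mono])
      then have "dist (f (u + t * (x - u) + 2 * of_int k * pi, v + t * (y - v) + 2 * of_int l * pi))
          (f (u + t' * (x - u) + 2 * of_int k * pi, v + t' * (y - v) + 2 * of_int l * pi)) \<le> ?M"
        using k l by (intro dist_le_modulus[OF assms(1)]) auto
      then show ?thesis by (simp add: P_def periodic_2pi_shift[OF per])
    qed
    \<comment> \<open>The crossings \<open>s\<close> and \<open>r\<close> may come in either order,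
      so the cuts are at their minimum and maximum. No crossing lies strictly between consecutive
      cuts, and degenerate pieces are covered by \<open>piece\<close> as well.\<close>
    have "dist (f (P 0)) (f (P 1)) \<le> dist (f (P 0)) (f (P (min s r))) +
        dist (f (P (min s r))) (f (P (max s r))) + dist (f (P (max s r))) (f (P 1))"
      using dist_triangle[of "f (P 0)" "f (P 1)" "f (P (min s r))"]
        dist_triangle[of "f (P (min s r))" "f (P 1)" "f (P (max s r))"] by linarith
    also have "\<dots> \<le> ?M + ?M + ?M"
      using s(1) r(1) by (intro add_mono piece) auto
    finally show ?thesis by (simp add: P_def)
  qed
  show "modulus UNIV f \<delta> \<le> 3 * ?M"
    unfolding modulus_def[of UNIV]
    by (rule cSup_least[OF nonempty]) (use main in \<open>auto simp: modulus_set_def\<close>)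
qed

end
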